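(* Let $p\in(0,1)$, $\alpha\in(0,1)$, and let $Z_1,\dots,Z_n$ be independent identically distributed real random variables with the law of an arbitrary real random variable $Z$, where $$n\geq \frac{\ln(\alpha)}{\ln(p)} .$$ Let $$\hat s_{\mathrm{b}}=\max\left\{k\in\{1,2,\dots,53\} \text{ such that } \forall i\in\{1,2,\dots,n\},\ |Z_i|<2^{-k}\right\}$$ (whenever this set is nonempty). Then $\hat s_{\mathrm{b}}$ is, with confidence level $1-\alpha$, a lower bound on the number of significant digits of $Z$ with probability $p$; that is, the probability (over $Z_1,\dots,Z_n$) that $\hat s_{\mathrm{b}}$ is defined and the $\hat s_{\mathrm{b}}$-th bit of $Z$ is not significant with probability $p$ is at most $\alpha$.
   Context: For an integer $k$, the $k$-th bit of $Z$ is said to be significant with probability $p$ if $\mathbb{P}(|Z|<2^{-k})\geq p$. The number of significant digits of $Z$ with probability $p$ is the largest real number $s$ such that $\mathbb{P}(|Z|<2^{-s})\geq p$; an integer $k$ is a lower bound on it exactly when the $k$-th bit of $Z$ is significant with probability $p$. No assumption is made on the distribution of $Z$. *)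

theory Defs
  imports "HOL-Probability.Probability"
begin

definition significant_bit :: "'a measure \<Rightarrow> ('a \<Rightarrow> real) \<Rightarrow> real \<Rightarrow> int \<Rightarrow> bool" where
  "significant_bit M Z p k \<longleftrightarrow> measure M {\<omega> \<in> space M. \<bar>Z \<omega>\<bar> < 2 powi (- k)} \<ge> p"

(* A relation rather than a function: the set of admissible s need not have a largest element
   (for Z constantly 1/2 and 0 < p \<le> 1 it is {s. s < 1}; for Z constantly 0 it is unbounded). *)
definition is_num_significant_digits :: "'a measure \<Rightarrow> ('a \<Rightarrow> real) \<Rightarrow> real \<Rightarrow> real \<Rightarrow> bool" where
  "is_num_significant_digits M Z p s \<longleftrightarrow>
     measure M {\<omega> \<in> space M. \<bar>Z \<omega>\<bar> < 2 powr (- s)} \<ge> p \<and>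
     (\<forall>t. measure M {\<omega> \<in> space M. \<bar>Z \<omega>\<bar> < 2 powr (- t)} \<ge> p \<longrightarrow> t \<le> s)"

lemma significant_bit_iff_le_num_significant_digits:
  assumes "prob_space M" and Z: "Z \<in> borel_measurable M"
    and s: "is_num_significant_digits M Z p s"
  shows "significant_bit M Z p k \<longleftrightarrow> real_of_int k \<le> s"
proof -
  interpret prob_space M by fact
  have k: "(2::real) powi (- k) = 2 powr (- real_of_int k)"
    using powr_real_of_int'[of "2::real" "- k"] by simp
  show ?thesis
  proof
    assume "significant_bit M Z p k"
    then show "real_of_int k \<le> s"
      using s by (simp add: significant_bit_def is_num_significant_digits_def k)
  next
    assume "real_of_int k \<le> s"
    then have le: "(2::real) powr (- s) \<le> 2 powr (- real_of_int k)" by simp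
    have "p \<le> measure M {\<omega> \<in> space M. \<bar>Z \<omega>\<bar> < 2 powr (- s)}"
      using s by (simp add: is_num_significant_digits_def)
    also have "\<dots> \<le> measure M {\<omega> \<in> space M. \<bar>Z \<omega>\<bar> < 2 powr (- real_of_int k)}"
      using Z by (intro finite_measure_mono) (auto intro: less_le_trans[OF _ le])
    finally show "significant_bit M Z p k"
      by (simp add: significant_bit_def k)
  qed
qed

definition sb_candidates :: "nat \<Rightarrow> (nat \<Rightarrow> real) \<Rightarrow> int set" where
  "sb_candidates n z = {k \<in> {1..53}. \<forall>i\<in>{1..n}. \<bar>z i\<bar> < 2 powi (- k)}"

(* Meaningful only when sb_candidates n z is nonempty. *)
definition s_hat_b :: "nat \<Rightarrow> (nat \<Rightarrow> real) \<Rightarrow> int" where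
  "s_hat_b n z = Max (sb_candidates n z)"

end

theory Submission
  imports Defs
begin

text \<open>
  Which bits fail to be significant depends on the law of \<open>Z\<close> only, not on the sample. If no bit
  among 1 to 53 fails, the estimator cannot be wrong; otherwise let \<open>m\<close> be the least one that
  fails. The estimator can be wrong only
  if it is at least \<open>m\<close>, and then the whole sample lies in the interval of radius \<open>2 powi (- m)\<close>.
  This turns the bad event, which involves a random bit, into a subset of one fixed event, so that
  no union bound over the bits is needed. By independence the fixed event has probability \<open>q ^ n\<close>,
  where \<open>q < p\<close> because bit \<open>m\<close> is not significant, and the sample size is chosen so that
  \<open>p ^ n \<le> \<alpha>\<close>.
\<close>

lemma power_le_of_ln_ratio_le:
  fixes p \<alpha> :: real
  assumes "0 < p" "p < 1" "0 < \<alpha>" and n: "real n \<ge> ln \<alpha> / ln p"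
  shows "p ^ n \<le> \<alpha>"
proof -
  have "ln p < 0" using assms by simp
  then have "real n * ln p \<le> ln \<alpha>"
    using n by (simp add: neg_divide_le_eq)
  then have "exp (real n * ln p) \<le> exp (ln \<alpha>)" by simp
  then show ?thesis
    using assms by (simp add: exp_of_nat_mult)
qed

lemma (in prob_space) prob_iid_sample_in_set:
  fixes X :: "'i \<Rightarrow> 'a \<Rightarrow> 'c::topological_space"
  assumes indep: "indep_vars (\<lambda>_. borel) X I" and I: "finite I" "I \<noteq> {}"
    and law: "\<And>i. i \<in> I \<Longrightarrow> distr M borel (X i) = D"
    and A: "A \<in> sets borel"
  shows "prob {\<omega> \<in> space M. \<forall>i\<in>I. X i \<omega> \<in> A} = measure D A ^ card I"
proof -
  have X: "X i \<in> borel_measurable M" if "i \<in> I" for i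
    using indep that by (simp add: indep_vars_def2)
  have "{\<omega> \<in> space M. \<forall>i\<in>I. X i \<omega> \<in> A} = (\<Inter>i\<in>I. X i -` A \<inter> space M)"
    using I by auto
  then have "prob {\<omega> \<in> space M. \<forall>i\<in>I. X i \<omega> \<in> A} = (\<Prod>i\<in>I. prob (X i -` A \<inter> space M))"
    using indep_varsD[OF indep I(2) I(1) order_refl] A by simp
  also have "\<dots> = (\<Prod>i\<in>I. measure D A)"
  proof (rule prod.cong[OF refl])
    fix i assume "i \<in> I"
    then show "prob (X i -` A \<inter> space M) = measure D A"
      using measure_distr[OF X A, of i] law[of i] by simp
  qed
  finally show ?thesis by simp
qed

lemma s_hat_b_in_sb_candidates:
  assumes "sb_candidates n z \<noteq> {}"
  shows "s_hat_b n z \<in> sb_candidates n z"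
proof -
  have "finite (sb_candidates n z)"
    by (rule finite_subset[of _ "{1..53}"]) (auto simp: sb_candidates_def)
  then show ?thesis
    unfolding s_hat_b_def using assms by (rule Max_in)
qed

theorem mainTheorem4:
  fixes p \<alpha> :: real and n :: nat
    and M :: "'a measure" and Z :: "'a \<Rightarrow> real"
    and N :: "'b measure" and X :: "nat \<Rightarrow> 'b \<Rightarrow> real"
  assumes "0 < p" and "p < 1" and "0 < \<alpha>" and "\<alpha> < 1"
    and "prob_space M" and "Z \<in> borel_measurable M"
    and "prob_space N"
    and "prob_space.indep_vars N (\<lambda>_. borel) X {1..n}"
    and "\<And>i. i \<in> {1..n} \<Longrightarrow> distr N borel (X i) = distr M borel Z"
    and "real n \<ge> ln \<alpha> / ln p"
  shows "measure N {\<omega> \<in> space N.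
           sb_candidates n (\<lambda>i. X i \<omega>) \<noteq> {} \<and>
           \<not> significant_bit M Z p (s_hat_b n (\<lambda>i. X i \<omega>))} \<le> \<alpha>"
proof -
  interpret N: prob_space N by fact
  define A :: "int \<Rightarrow> real set" where "A k = {x. \<bar>x\<bar> < 2 powi (- k)}" for k
  define B where "B = {k \<in> {1..53}. \<not> significant_bit M Z p k}"
  define bad where "bad = {\<omega> \<in> space N. sb_candidates n (\<lambda>i. X i \<omega>) \<noteq> {} \<and>
           \<not> significant_bit M Z p (s_hat_b n (\<lambda>i. X i \<omega>))}"
  have s_hat_in_B: "s_hat_b n (\<lambda>i. X i \<omega>) \<in> B" if "\<omega> \<in> bad" for \<omega>
    using that s_hat_b_in_sb_candidates[of n "\<lambda>i. X i \<omega>"]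
    by (auto simp: bad_def B_def sb_candidates_def)
  have "measure N bad \<le> \<alpha>"
  proof (cases "B = {}")
    case True
    then have "bad = {}" using s_hat_in_B by auto
    then show ?thesis using \<open>0 < \<alpha>\<close> by simp
  next
    case False
    define m where "m = Min B"
    have "finite B" by (rule finite_subset[of _ "{1..53}"]) (auto simp: B_def)
    then have "m \<in> B" and m_le: "\<And>k. k \<in> B \<Longrightarrow> m \<le> k"
      using False by (auto simp: m_def)
    \<comment> \<open>The product rule for independent variables needs a nonempty index set. Since both logarithms
      are negative, the bound on \<open>n\<close> is positive.\<close>
    have "ln \<alpha> / ln p > 0"
      using assms(1-4) by (simp add: divide_neg_neg)
    then have "{1..n} \<noteq> {}" using assms(10) by (cases n) auto
    have A: "A m \<in> sets borel" unfolding A_def by measurable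
    have q_less: "measure (distr M borel Z) (A m) < p"
    proof -
      have "Z -` A m \<inter> space M = {\<omega> \<in> space M. \<bar>Z \<omega>\<bar> < 2 powi (- m)}"
        by (auto simp: A_def)
      then show ?thesis
        using \<open>m \<in> B\<close> measure_distr[OF assms(6) A] by (simp add: B_def significant_bit_def)
    qed
    have "bad \<subseteq> {\<omega> \<in> space N. \<forall>i\<in>{1..n}. X i \<omega> \<in> A m}"
    proof (intro subsetI CollectI conjI ballI)
      fix \<omega> i assume \<omega>: "\<omega> \<in> bad" and i: "i \<in> {1..n}"
      let ?k = "s_hat_b n (\<lambda>i. X i \<omega>)"
      have "?k \<in> sb_candidates n (\<lambda>i. X i \<omega>)"
        using \<omega> by (intro s_hat_b_in_sb_candidates) (simp add: bad_def)
      then have "\<bar>X i \<omega>\<bar> < 2 powi (- ?k)"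
        using i by (simp add: sb_candidates_def)
      also have "\<dots> \<le> 2 powi (- m)"
        using m_le[OF s_hat_in_B[OF \<omega>]] by (intro power_int_increasing) auto
      finally show "X i \<omega> \<in> A m" by (simp add: A_def)
    qed (simp add: bad_def)
    moreover have "{\<omega> \<in> space N. \<forall>i\<in>{1..n}. X i \<omega> \<in> A m} \<in> sets N"
    proof (rule sets.sets_Collect_finite_All)
      fix i assume "i \<in> {1..n}"
      with assms(8) have "X i \<in> borel_measurable N" by (simp add: N.indep_vars_def2)
      then show "{\<omega> \<in> space N. X i \<omega> \<in> A m} \<in> sets N"
        using A by measurable
    qed simp
    ultimately have "measure N bad \<le> measure N {\<omega> \<in> space N. \<forall>i\<in>{1..n}. X i \<omega> \<in> A m}"
      by (rule N.finite_measure_mono)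
    also have "\<dots> = measure (distr M borel Z) (A m) ^ n"
      using N.prob_iid_sample_in_set[OF assms(8) _ \<open>{1..n} \<noteq> {}\<close> assms(9) A] by simp
    also have "\<dots> \<le> p ^ n"
      using q_less by (intro power_mono) auto
    also have "\<dots> \<le> \<alpha>"
      using assms(1,2,3,10) by (rule power_le_of_ln_ratio_le)
    finally show ?thesis .
  qed
  then show ?thesis by (simp add: bad_def)
qed

end
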